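(* Let $G$ be a finite group. The Laplacians $\{\mathcal{L}_K\}_{K\in\mathcal{K}}$ are linearly independent over $\mathbb{R}$, and for every admissible operator $T$ on $L^2(G)$ there is an $\alpha=(\alpha_K)_{K\in\mathcal{K}}\in\mathbb{R}^{|\mathcal{K}|}$ with $$\omega_T=\sum_{K\in\mathcal{K}}\alpha_K\omega_K$$ as functions on $\widehat{G}$.
   Context: $L^2(G)$ is the space of functions $f:G\to\mathbb{C}$ with inner product $\langle f,h\rangle=\frac{1}{|G|}\sum_{g\in G}\overline{f(g)}h(g)$. A linear operator $T:L^2(G)\to L^2(G)$ is admissible if it is Hermitian, commutes with all left translations $(L_af)(g)=f(a^{-1}g)$, $a\in G$, annihilates the constant functions, and satisfies $\langle\overline{f},T\overline{f}\rangle=\langle f,Tf\rangle$ for every $f\in L^2(G)$. $\widehat{G}$ is the set of equivalence classes of irreducible complex representations of $G$, each represented by a unitary matrix representation $\sigma:G\to U(d_\sigma)$ with matrix entries $\sigma_{ij}$, and $\mathcal{A}_\sigma=\operatorname{span}\{\sigma_{ij}\}\subseteq L^2(G)$; every admissible $T$ preserves each $\mathcal{A}_\sigma$. For admissible $T$, $\omega_T(\sigma)$ is the mean of the eigenvalues (with multiplicity) of $T$ restricted to $\mathcal{A}_\sigma$. $\mathcal{K}$ is the collection of sets $C\cup C^{-1}$ as $C$ ranges over the nontrivial conjugacy classes of $G$ (those other than $\{e\}$). For $K\in\mathcal{K}$, $(A_Kf)(g)=\frac{1}{|K|}\sum_{s\in K}f(gs)$, $\mathcal{L}_K=I-A_K$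 (which is admissible), and $\omega_K:=\omega_{\mathcal{L}_K}$. *)

theory Defs
  imports
    "HOL-Algebra.Algebra"
    "HOL-Library.Function_Algebras"
    "Jordan_Normal_Form.Schur_Decomposition"
    "Jordan_Normal_Form.VS_Connect"
begin

subsection \<open>Functions on a finite group\<close>

definition fscale :: "complex \<Rightarrow> ('a \<Rightarrow> complex) \<Rightarrow> 'a \<Rightarrow> complex" (infixr \<open>*\<^sub>f\<close> 75)
  where "c *\<^sub>f f = (\<lambda>x. c * f x)"

global_interpretation cfun: vector_space fscale
  by unfold_locales (auto simp: fscale_def fun_eq_iff algebra_simps)

text \<open>Functions on the group are represented by functions on the ambient type that vanish
  outside the carrier, so that equality of functions is equality on the carrier.\<close>

definition restr :: "('a, 'b) monoid_scheme \<Rightarrow> ('a \<Rightarrow> complex) \<Rightarrow> 'a \<Rightarrow> complex"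
  where "restr G f = (\<lambda>g. if g \<in> carrier G then f g else 0)"

definition L2 :: "('a, 'b) monoid_scheme \<Rightarrow> ('a \<Rightarrow> complex) set"
  where "L2 G = {f. \<forall>g. g \<notin> carrier G \<longrightarrow> f g = 0}"

definition L2_inner :: "('a, 'b) monoid_scheme \<Rightarrow> ('a \<Rightarrow> complex) \<Rightarrow> ('a \<Rightarrow> complex) \<Rightarrow> complex"
  where "L2_inner G f h = (1 / of_nat (card (carrier G))) * (\<Sum>g\<in>carrier G. cnj (f g) * h g)"

definition left_translation ::
    "('a, 'b) monoid_scheme \<Rightarrow> 'a \<Rightarrow> ('a \<Rightarrow> complex) \<Rightarrow> 'a \<Rightarrow> complex"
  where "left_translation G a f = restr G (\<lambda>g. f (inv\<^bsub>G\<^esub> a \<otimes>\<^bsub>G\<^esub> g))"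

text \<open>Operators on \<open>L2 G\<close> are functions on the whole function type of which only the values on
  \<open>L2 G\<close> matter.\<close>

definition L2_linear :: "('a, 'b) monoid_scheme \<Rightarrow> (('a \<Rightarrow> complex) \<Rightarrow> 'a \<Rightarrow> complex) \<Rightarrow> bool"
  where "L2_linear G T \<longleftrightarrow>
    T \<in> L2 G \<rightarrow> L2 G \<and>
    (\<forall>f\<in>L2 G. \<forall>h\<in>L2 G. T (f + h) = T f + T h) \<and>
    (\<forall>c. \<forall>f\<in>L2 G. T (c *\<^sub>f f) = c *\<^sub>f T f)"

definition admissible :: "('a, 'b) monoid_scheme \<Rightarrow> (('a \<Rightarrow> complex) \<Rightarrow> 'a \<Rightarrow> complex) \<Rightarrow> bool"
  where "admissible G T \<longleftrightarrow>
    L2_linear G T \<and>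
    (\<forall>f\<in>L2 G. \<forall>h\<in>L2 G. L2_inner G (T f) h = L2_inner G f (T h)) \<and>
    (\<forall>a\<in>carrier G. \<forall>f\<in>L2 G. T (left_translation G a f) = left_translation G a (T f)) \<and>
    (\<forall>c. T (restr G (\<lambda>_. c)) = 0) \<and>
    (\<forall>f\<in>L2 G. L2_inner G (cnj \<circ> f) (T (cnj \<circ> f)) = L2_inner G f (T f))"

subsection \<open>Irreducible representations\<close>

abbreviation GL_complex :: "nat \<Rightarrow> complex mat monoid"
  where "GL_complex d \<equiv> units_of (ring_mat TYPE(complex) d ())"

definition rep_dim :: "('a, 'b) monoid_scheme \<Rightarrow> ('a \<Rightarrow> complex mat) \<Rightarrow> nat"
  where "rep_dim G \<sigma> = dim_row (\<sigma> \<one>\<^bsub>G\<^esub>)"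

definition matrix_rep :: "('a, 'b) monoid_scheme \<Rightarrow> ('a \<Rightarrow> complex mat) \<Rightarrow> bool"
  where "matrix_rep G \<sigma> \<longleftrightarrow> \<sigma> \<in> hom G (GL_complex (rep_dim G \<sigma>))"

definition irreducible_rep :: "('a, 'b) monoid_scheme \<Rightarrow> ('a \<Rightarrow> complex mat) \<Rightarrow> bool"
  where "irreducible_rep G \<sigma> \<longleftrightarrow>
    matrix_rep G \<sigma> \<and> rep_dim G \<sigma> > 0 \<and>
    (\<forall>W. VectorSpace.subspace class_ring W (module_vec TYPE(complex) (rep_dim G \<sigma>)) \<longrightarrow>
         (\<forall>g\<in>carrier G. \<forall>w\<in>W. \<sigma> g *\<^sub>v w \<in> W) \<longrightarrow>
         W = {0\<^sub>v (rep_dim G \<sigma>)} \<or> W = carrier_vec (rep_dim G \<sigma>))"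

definition unitary_rep :: "('a, 'b) monoid_scheme \<Rightarrow> ('a \<Rightarrow> complex mat) \<Rightarrow> bool"
  where "unitary_rep G \<sigma> \<longleftrightarrow>
    matrix_rep G \<sigma> \<and> (\<forall>g\<in>carrier G. mat_adjoint (\<sigma> g) * \<sigma> g = 1\<^sub>m (rep_dim G \<sigma>))"

definition irrep_equiv ::
    "('a, 'b) monoid_scheme \<Rightarrow> (('a \<Rightarrow> complex mat) \<times> ('a \<Rightarrow> complex mat)) set"
  where "irrep_equiv G = {(\<sigma>, \<tau>). irreducible_rep G \<sigma> \<and> irreducible_rep G \<tau> \<and>
    rep_dim G \<sigma> = rep_dim G \<tau> \<and>
    (\<exists>P \<in> carrier (GL_complex (rep_dim G \<sigma>)). \<forall>g\<in>carrier G. P * \<sigma> g = \<tau> g * P)}"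

definition dual :: "('a, 'b) monoid_scheme \<Rightarrow> ('a \<Rightarrow> complex mat) set set"
  where "dual G = {\<sigma>. irreducible_rep G \<sigma>} // irrep_equiv G"

definition coeff_space :: "('a, 'b) monoid_scheme \<Rightarrow> ('a \<Rightarrow> complex mat) \<Rightarrow> ('a \<Rightarrow> complex) set"
  where "coeff_space G \<sigma> =
    cfun.span {restr G (\<lambda>g. \<sigma> g $$ (i, j)) | i j. i < rep_dim G \<sigma> \<and> j < rep_dim G \<sigma>}"

subsection \<open>Mean of the eigenvalues\<close>

definition eigenspace_on ::
    "(('a \<Rightarrow> complex) \<Rightarrow> 'a \<Rightarrow> complex) \<Rightarrow> ('a \<Rightarrow> complex) set \<Rightarrow> complex \<Rightarrow> ('a \<Rightarrow> complex) set"
  where "eigenspace_on T A \<mu> = {f\<in>A. T f = \<mu> *\<^sub>f f}"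

definition eigenvalues_on ::
    "(('a \<Rightarrow> complex) \<Rightarrow> 'a \<Rightarrow> complex) \<Rightarrow> ('a \<Rightarrow> complex) set \<Rightarrow> complex set"
  where "eigenvalues_on T A = {\<mu>. \<exists>f\<in>eigenspace_on T A \<mu>. f \<noteq> 0}"

text \<open>The multiplicity of an eigenvalue is the dimension of its eigenspace; the operators
  considered are Hermitian, so that geometric and algebraic multiplicities agree.\<close>

definition mean_eigenvalue ::
    "(('a \<Rightarrow> complex) \<Rightarrow> 'a \<Rightarrow> complex) \<Rightarrow> ('a \<Rightarrow> complex) set \<Rightarrow> complex"
  where "mean_eigenvalue T A =
    (\<Sum>\<mu>\<in>eigenvalues_on T A. of_nat (cfun.dim (eigenspace_on T A \<mu>)) * \<mu>) /
    (\<Sum>\<mu>\<in>eigenvalues_on T A. of_nat (cfun.dim (eigenspace_on T A \<mu>)))"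

definition omega ::
    "('a, 'b) monoid_scheme \<Rightarrow> (('a \<Rightarrow> complex) \<Rightarrow> 'a \<Rightarrow> complex) \<Rightarrow> ('a \<Rightarrow> complex mat) \<Rightarrow> complex"
  where "omega G T \<sigma> = mean_eigenvalue T (coeff_space G \<sigma>)"

subsection \<open>Conjugacy-class Laplacians\<close>

definition conjugacy_classes :: "('a, 'b) monoid_scheme \<Rightarrow> 'a set set"
  where "conjugacy_classes G = orbits G (carrier G) (\<lambda>g x. g \<otimes>\<^bsub>G\<^esub> x \<otimes>\<^bsub>G\<^esub> inv\<^bsub>G\<^esub> g)"

definition sym_classes :: "('a, 'b) monoid_scheme \<Rightarrow> 'a set set"
  where "sym_classes G = {C \<union> set_inv\<^bsub>G\<^esub> C | C. C \<in> conjugacy_classes G \<and> C \<noteq> {\<one>\<^bsub>G\<^esub>}}"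

definition averaging ::
    "('a, 'b) monoid_scheme \<Rightarrow> 'a set \<Rightarrow> ('a \<Rightarrow> complex) \<Rightarrow> 'a \<Rightarrow> complex"
  where "averaging G K f =
    restr G (\<lambda>g. (1 / of_nat (card K)) * (\<Sum>s\<in>K. f (g \<otimes>\<^bsub>G\<^esub> s)))"

definition laplacian ::
    "('a, 'b) monoid_scheme \<Rightarrow> 'a set \<Rightarrow> ('a \<Rightarrow> complex) \<Rightarrow> 'a \<Rightarrow> complex"
  where "laplacian G K f = f - averaging G K f"

end

theory Submission
  imports Defs
begin

text \<open>An admissible operator commutes with left translations, hence is a right convolution by some
  kernel \<open>k\<close>; the remaining conditions say that \<open>k\<close> is real, invariant under inversion and of sum
  zero. Since the coefficient space \<open>A\<close> of a representation is invariant under the right translations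
  \<open>R s\<close>, the mean eigenvalue on \<open>A\<close> is \<open>(\<Sum>s. k s * tr (R s)) / dim A\<close>, and \<open>tr (R s)\<close> is a class function of
  \<open>s\<close>. Only the sums of \<open>k\<close> over the sets \<open>C \<union> C\<^sup>-\<^sup>1\<close> therefore matter, so \<open>T\<close> has the same means as
  \<open>\<Sum>K. \<alpha> K * laplacian K\<close> with \<open>\<alpha> K = - (\<Sum>s\<in>K. k s)\<close>. Linear independence follows by applying a
  vanishing combination to the point mass at the identity.\<close>

subsection \<open>Orthonormal families of finitely supported functions\<close>

lemma sum_fun_apply: "(\<Sum>i\<in>I. f i) x = (\<Sum>i\<in>I. f i x :: complex)"
  by (induction I rule: infinite_finite_induct) auto

text \<open>The inner product of \<open>L2\<close> without the factor 1/|G| and over any index set: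
  point masses become orthonormal, and adjoints are the same as for \<open>L2_inner\<close>.\<close>

definition finner :: "'a set \<Rightarrow> ('a \<Rightarrow> complex) \<Rightarrow> ('a \<Rightarrow> complex) \<Rightarrow> complex"
  where "finner S f h = (\<Sum>x\<in>S. cnj (f x) * h x)"

lemma finner_add_right: "finner S f (h + k) = finner S f h + finner S f k"
  by (simp add: finner_def algebra_simps sum.distrib)

lemma finner_diff_right: "finner S f (h - k) = finner S f h - finner S f k"
  by (simp add: finner_def algebra_simps sum_subtractf)

lemma finner_scale_right: "finner S f (c *\<^sub>f h) = c * finner S f h"
  by (simp add: finner_def fscale_def sum_distrib_left algebra_simps)

lemma finner_scale_left: "finner S (c *\<^sub>f f) h = cnj c * finner S f h"
  by (simp add: finner_def fscale_def sum_distrib_left algebra_simps)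

lemma finner_sum_right: "finner S f (\<Sum>i\<in>I. h i) = (\<Sum>i\<in>I. finner S f (h i))"
  unfolding finner_def sum_fun_apply sum_distrib_left by (rule sum.swap)

lemma finner_zero_right [simp]: "finner S f 0 = 0"
  by (simp add: finner_def)

lemma cnj_finner: "cnj (finner S f h) = finner S h f"
  by (simp add: finner_def mult.commute)

lemma finner_self: "finner S f f = complex_of_real (\<Sum>x\<in>S. (cmod (f x))\<^sup>2)"
proof -
  have "cnj (f x) * f x = complex_of_real ((cmod (f x))\<^sup>2)" for x
    using complex_norm_square[of "f x"] by (simp add: mult.commute)
  then show ?thesis
    by (simp add: finner_def)
qed

definition orthonormal :: "'a set \<Rightarrow> ('a \<Rightarrow> complex) set \<Rightarrow> bool"
  where "orthonormal S B \<longleftrightarrow> (\<forall>b\<in>B. \<forall>c\<in>B. finner S b c = (if b = c then 1 else 0))"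

lemma orthonormal_subset: "orthonormal S B \<Longrightarrow> C \<subseteq> B \<Longrightarrow> orthonormal S C"
  unfolding orthonormal_def by blast

lemma finner_orthonormal_sum:
  assumes "orthonormal S B" "finite B'" "B' \<subseteq> B" "b \<in> B'"
  shows "finner S b (\<Sum>c\<in>B'. u c *\<^sub>f c) = u b"
proof -
  have "finner S b (\<Sum>c\<in>B'. u c *\<^sub>f c) = (\<Sum>c\<in>B'. if c = b then u c else 0)"
    unfolding finner_sum_right using assms
    by (intro sum.cong) (auto simp: orthonormal_def finner_scale_right subset_iff)
  then show ?thesis
    using assms by simp
qed

lemma orthonormal_independent:
  assumes "orthonormal S B"
  shows "cfun.independent B"
  unfolding cfun.independent_explicit_module
proof (intro allI impI)
  fix t u v
  assume t: "finite t" "t \<subseteq> B" "(\<Sum>v\<in>t. u v *\<^sub>f v) = 0" "v \<in> t"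
  then show "u v = 0"
    using finner_orthonormal_sum[OF assms t(1,2,4), of u] by simp
qed

lemma sum_in_span: "(\<Sum>b\<in>B. u b *\<^sub>f b) \<in> cfun.span B"
  by (intro cfun.span_sum cfun.span_scale cfun.span_base)

section \<open>Orthonormal bases of spaces of finitely supported functions\<close>

locale finite_subspace =
  fixes S :: "'a set" and A :: "('a \<Rightarrow> complex) set"
  assumes finite_S: "finite S" and subsp: "cfun.subspace A"
    and supp: "\<And>f x. f \<in> A \<Longrightarrow> x \<notin> S \<Longrightarrow> f x = 0"
begin

text \<open>A zero norm forces only the values on \<open>S\<close> to vanish; \<open>supp\<close>
  takes care of the rest of the type.\<close>

lemma finner_self_eq_0:
  assumes "f \<in> A" "finner S f f = 0"
  shows "f = 0"
proof
  fix x
  have "(\<Sum>x\<in>S. (cmod (f x))\<^sup>2) = 0"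
    using assms(2) unfolding finner_self of_real_eq_0_iff .
  then have "\<forall>x\<in>S. (cmod (f x))\<^sup>2 = 0"
    by (subst (asm) sum_nonneg_eq_0_iff) (use finite_S in auto)
  then show "f x = 0 x"
    using supp[OF assms(1), of x] by (cases "x \<in> S") auto
qed

text \<open>\<open>A\<close> lies in the span of the point masses on \<open>S\<close>, so the
  exchange bound yields finite dimension, which the locale does not assume directly.\<close>

lemma independent_finite_card:
  assumes "B \<subseteq> A" "cfun.independent B"
  shows "finite B \<and> card B \<le> card S"
proof -
  define D where "D = (\<lambda>s x. if x = s then 1 else 0 :: complex) ` S"
  have "f \<in> cfun.span D" if "f \<in> A" for f
  proof -
    have "f = (\<Sum>s\<in>S. f s *\<^sub>f (\<lambda>x. if x = s then 1 else 0))"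
      using supp[OF that] finite_S by (auto simp: fun_eq_iff sum_fun_apply fscale_def if_distrib cong: if_cong)
    also have "\<dots> \<in> cfun.span D"
      unfolding D_def by (intro cfun.span_sum cfun.span_scale cfun.span_base) auto
    finally show ?thesis .
  qed
  then have "finite B \<and> card B \<le> card D"
    using assms finite_S by (intro cfun.independent_span_bound) (auto simp: D_def)
  moreover have "card D \<le> card S"
    unfolding D_def by (rule card_image_le[OF finite_S])
  ultimately show ?thesis
    by linarith
qed

lemma orthonormal_finite:
  assumes "B \<subseteq> A" "orthonormal S B"
  shows "finite B" "card B \<le> card S"
  using independent_finite_card assms orthonormal_independent by blast+

text \<open>An orthonormal family in \<open>V\<close> of largest cardinality works: a nonzero vector
  of \<open>V\<close> orthogonal to it could be normalized and adjoined. Asking for closure under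
  scaling instead of a subspace lets \<open>V\<close> be a set of eigenvectors for different
  eigenvalues.\<close>

lemma maximal_orthonormal:
  assumes "V \<subseteq> A" and scale: "\<And>c f. f \<in> V \<Longrightarrow> c *\<^sub>f f \<in> V"
  obtains B where "B \<subseteq> V" "orthonormal S B"
    "\<And>f. f \<in> V \<Longrightarrow> (\<And>b. b \<in> B \<Longrightarrow> finner S b f = 0) \<Longrightarrow> f = 0"
proof -
  define P where "P B \<longleftrightarrow> B \<subseteq> V \<and> orthonormal S B" for B
  have "\<exists>B. P B \<and> (\<forall>B'. P B' \<longrightarrow> card B' \<le> card B)"
  \<comment> \<open>The rule wants a strict bound on the cardinality, hence the successor; the empty
    family starts the search.\<close>
  proof (rule ex_has_greatest_nat[of _ "{}" _ "Suc (card S)"])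
    show "P {}"
      by (simp add: P_def orthonormal_def)
    show "\<forall>B. P B \<longrightarrow> card B < Suc (card S)"
      using assms(1) orthonormal_finite(2) by (auto simp: P_def less_Suc_eq_le)
  qed
  then obtain B where B: "B \<subseteq> V" "orthonormal S B"
    and max: "\<And>B'. B' \<subseteq> V \<Longrightarrow> orthonormal S B' \<Longrightarrow> card B' \<le> card B"
    unfolding P_def by auto
  show ?thesis
  proof (rule that[OF B], rule ccontr)
    fix f
    assume f: "f \<in> V" "\<And>b. b \<in> B \<Longrightarrow> finner S b f = 0" "f \<noteq> 0"
    define r where "r = (\<Sum>x\<in>S. (cmod (f x))\<^sup>2)"
    have ff: "finner S f f = complex_of_real r"
      by (simp add: finner_self r_def)
    have "r \<noteq> 0"
      using finner_self_eq_0 f ff assms(1) by auto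
    moreover have "r \<ge> 0"
      unfolding r_def by (rule sum_nonneg) auto
    ultimately have r: "r > 0"
      by simp
    define e where "e = complex_of_real (1 / sqrt r) *\<^sub>f f"
    have "complex_of_real (1 / sqrt r) * (complex_of_real (1 / sqrt r) * complex_of_real r) = 1"
      unfolding of_real_mult[symmetric] using r by (simp add: field_simps)
    then have ee: "finner S e e = 1"
      by (simp add: e_def finner_scale_left finner_scale_right ff)
    have be: "finner S b e = 0" if "b \<in> B" for b
      using f(2)[OF that] by (simp add: e_def finner_scale_right)
    have eb: "finner S e b = 0" if "b \<in> B" for b
      using be[OF that] cnj_finner[of S b e] by simp
    have "e \<notin> B"
      using ee be by auto
    moreover have "orthonormal S (insert e B)"
      using B(2) ee be eb \<open>e \<notin> B\<close> unfolding orthonormal_def by auto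
    moreover have "insert e B \<subseteq> V"
      using B f(1) scale by (auto simp: e_def)
    moreover have "finite B"
      using orthonormal_finite B assms(1) by blast
    ultimately show False
      using max[of "insert e B"] by simp
  qed
qed

definition onb :: "('a \<Rightarrow> complex) set \<Rightarrow> bool"
  where "onb B \<longleftrightarrow> B \<subseteq> A \<and> orthonormal S B \<and> (\<forall>f\<in>A. f = (\<Sum>b\<in>B. finner S b f *\<^sub>f b))"

lemma onb_subset: "onb B \<Longrightarrow> B \<subseteq> A" and onb_orthonormal: "onb B \<Longrightarrow> orthonormal S B"
  by (simp_all only: onb_def)

lemma onb_finite: "onb B \<Longrightarrow> finite B"
  using orthonormal_finite onb_subset onb_orthonormal by blast

lemma onb_expand: "onb B \<Longrightarrow> f \<in> A \<Longrightarrow> (\<Sum>b\<in>B. finner S b f *\<^sub>f b) = f"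
  unfolding onb_def by metis

lemma orthonormal_residual:
  assumes "B \<subseteq> A" "orthonormal S B" "f \<in> A"
  defines "r \<equiv> f - (\<Sum>b\<in>B. finner S b f *\<^sub>f b)"
  shows "r \<in> A" "b \<in> B \<Longrightarrow> finner S b r = 0"
proof -
  show "r \<in> A"
    unfolding r_def using assms(1,3)
    by (intro cfun.subspace_diff cfun.subspace_sum cfun.subspace_scale subsp) auto
  show "finner S b r = 0" if "b \<in> B"
    using finner_orthonormal_sum[OF assms(2) orthonormal_finite(1)[OF assms(1,2)] order_refl that]
    by (simp add: r_def finner_diff_right)
qed

text \<open>The residual of \<open>f\<close> after projection onto the span of \<open>B\<close> lies
  in \<open>A\<close> and is orthogonal to \<open>B\<close>, so the third hypothesis makes it
  zero.\<close>

lemma onbI: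
  assumes "B \<subseteq> A" "orthonormal S B"
    and "\<And>f. f \<in> A \<Longrightarrow> (\<And>b. b \<in> B \<Longrightarrow> finner S b f = 0) \<Longrightarrow> f = 0"
  shows "onb B"
  unfolding onb_def
proof (intro conjI assms ballI)
  fix f assume "f \<in> A"
  from assms(3)[OF orthonormal_residual[OF assms(1,2) this]]
  show "f = (\<Sum>b\<in>B. finner S b f *\<^sub>f b)"
    by simp
qed

text \<open>The sum is the kernel function of the orthogonal projection onto \<open>A\<close> and so
  depends on \<open>A\<close> alone. Expanding the members of each basis in the other one and
  exchanging the sums shows this directly.\<close>

lemma onb_kernel_unique:
  assumes "onb B" "onb B'"
  shows "(\<Sum>b\<in>B. b x * cnj (b y)) = (\<Sum>b\<in>B'. b x * cnj (b y))"
proof -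
  have sub: "B \<subseteq> A" "B' \<subseteq> A"
    using assms onb_subset by auto
  have e1: "b x = (\<Sum>c\<in>B'. finner S c b * c x)" if "b \<in> B" for b
    using arg_cong[OF onb_expand[OF assms(2), of b], of "\<lambda>f. f x"] that sub
    by (auto simp: sum_fun_apply fscale_def)
  have e2: "cnj (c y) = (\<Sum>b\<in>B. finner S c b * cnj (b y))" if "c \<in> B'" for c
    using arg_cong[OF onb_expand[OF assms(1), of c], of "\<lambda>f. cnj (f y)"] that sub
    by (auto simp: sum_fun_apply fscale_def cnj_finner)
  have "(\<Sum>b\<in>B. b x * cnj (b y)) = (\<Sum>b\<in>B. \<Sum>c\<in>B'. finner S c b * c x * cnj (b y))"
    by (intro sum.cong refl) (subst e1, auto simp: sum_distrib_right)
  also have "\<dots> = (\<Sum>c\<in>B'. \<Sum>b\<in>B. finner S c b * c x * cnj (b y))"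
    by (rule sum.swap)
  also have "\<dots> = (\<Sum>c\<in>B'. c x * cnj (c y))"
    by (intro sum.cong refl) (subst e2, auto simp: sum_distrib_left algebra_simps)
  finally show ?thesis .
qed

lemma obtain_onb:
  obtains B where "onb B"
  using maximal_orthonormal[of A] cfun.subspace_scale[OF subsp] onbI
  by (metis order_refl)

lemma dim_onb: "onb B \<Longrightarrow> cfun.dim A = card B"
proof (rule cfun.dim_unique)
  assume B: "onb B"
  show "A \<subseteq> cfun.span B"
  proof
    fix f assume "f \<in> A"
    from onb_expand[OF B this] show "f \<in> cfun.span B"
      using sum_in_span[of "\<lambda>b. finner S b f" B] by simp
  qed
qed (use onb_subset onb_orthonormal orthonormal_independent in blast)+

end

subsection \<open>The spectral theorem\<close>

text \<open>The vector p(T) v in Horner form. It is attached to a single vector because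
  \<open>T\<close> will be linear only on a subspace.\<close>

definition op_poly ::
    "(('a \<Rightarrow> complex) \<Rightarrow> 'a \<Rightarrow> complex) \<Rightarrow> complex poly \<Rightarrow> ('a \<Rightarrow> complex) \<Rightarrow> 'a \<Rightarrow> complex"
  where "op_poly T p v = fold_coeffs (\<lambda>a h. a *\<^sub>f v + T h) p 0"

locale finite_operator = finite_subspace +
  fixes T :: "('a \<Rightarrow> complex) \<Rightarrow> 'a \<Rightarrow> complex"
  assumes T_closed: "f \<in> A \<Longrightarrow> T f \<in> A"
    and T_add: "f \<in> A \<Longrightarrow> h \<in> A \<Longrightarrow> T (f + h) = T f + T h"
    and T_scale: "f \<in> A \<Longrightarrow> T (c *\<^sub>f f) = c *\<^sub>f T f"
begin

lemma T_zero [simp]: "T 0 = 0"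
  using T_scale[of 0 0] cfun.subspace_0[OF subsp] by simp

lemma T_sum:
  assumes "finite I" "\<And>i. i \<in> I \<Longrightarrow> b i \<in> A"
  shows "T (\<Sum>i\<in>I. u i *\<^sub>f b i) = (\<Sum>i\<in>I. u i *\<^sub>f T (b i))"
  using assms
proof (induction I rule: finite_induct)
  case (insert j I)
  have "(\<Sum>i\<in>I. u i *\<^sub>f b i) \<in> A" "u j *\<^sub>f b j \<in> A" "b j \<in> A"
    using insert by (auto intro!: cfun.subspace_sum cfun.subspace_scale subsp)
  with insert show ?case
    by (simp add: T_add T_scale del: plus_fun_apply)
qed simp

lemma op_poly_0 [simp]: "op_poly T 0 v = 0"
  by (simp add: op_poly_def)

lemma op_poly_pCons [simp]: "op_poly T (pCons a p) v = a *\<^sub>f v + T (op_poly T p v)"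
  by (cases "p = 0 \<and> a = 0") (auto simp: op_poly_def)

lemma op_poly_closed: "v \<in> A \<Longrightarrow> op_poly T p v \<in> A"
  by (induction p)
    (auto intro!: cfun.subspace_add cfun.subspace_scale T_closed subsp cfun.subspace_0)

lemma op_poly_add: "v \<in> A \<Longrightarrow> op_poly T (p + q) v = op_poly T p v + op_poly T q v"
  by (induction p q rule: poly_induct2)
    (auto simp: T_add op_poly_closed cfun.scale_left_distrib)

lemma op_poly_smult: "v \<in> A \<Longrightarrow> op_poly T (Polynomial.smult c p) v = c *\<^sub>f op_poly T p v"
  by (induction p) (auto simp: T_scale op_poly_closed cfun.scale_right_distrib)

lemma op_poly_monom: "v \<in> A \<Longrightarrow> op_poly T (Polynomial.monom c n) v = c *\<^sub>f (T ^^ n) v"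
proof (induction n)
  case (Suc n)
  have "(T ^^ n) v \<in> A"
    using Suc.prems by (induction n) (auto intro: T_closed)
  then have "T (c *\<^sub>f (T ^^ n) v) = c *\<^sub>f T ((T ^^ n) v)"
    by (rule T_scale)
  with Suc show ?case
    by (simp add: monom_Suc)
qed (simp add: monom_0)

lemma op_poly_sum: "v \<in> A \<Longrightarrow> op_poly T (\<Sum>i\<in>I. p i) v = (\<Sum>i\<in>I. op_poly T (p i) v)"
  by (induction I rule: infinite_finite_induct) (auto simp: op_poly_add)

text \<open>Induction on the degree. A root z splits \<open>p\<close> as (X - z) q: either q(T) v
  vanishes and \<open>q\<close> has smaller degree, or q(T) v is itself an eigenvector for z. A
  nonzero constant cannot annihilate \<open>v\<close>.\<close>

lemma annihilating_poly_eigenvector: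
  assumes "v \<in> A" "v \<noteq> 0" "p \<noteq> 0" "op_poly T p v = 0"
  shows "\<exists>\<mu> w. w \<in> A \<and> w \<noteq> 0 \<and> T w = \<mu> *\<^sub>f w"
  using assms
proof (induction "Polynomial.degree p" arbitrary: p)
  case 0
  then obtain a where "p = [:a:]"
    by (metis degree_eq_zeroE)
  with 0 have "a \<noteq> 0" "a *\<^sub>f v = 0"
    by auto
  with \<open>v \<noteq> 0\<close> show ?case
    by simp
next
  case (Suc n)
  then have "\<not> constant (Polynomial.poly p)"
    by (simp add: constant_degree)
  then obtain z where "Polynomial.poly p z = 0"
    using fundamental_theorem_of_algebra by blast
  then obtain q where p: "p = [:- z, 1:] * q"
    unfolding poly_eq_0_iff_dvd by (elim dvdE)
  have q: "q \<noteq> 0"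
    using Suc.prems p by auto
  have "p = Polynomial.smult (- z) q + pCons 0 q"
    unfolding p by simp
  then have "op_poly T p v = - z *\<^sub>f op_poly T q v + T (op_poly T q v)"
    using Suc.prems(1) by (simp only: op_poly_add op_poly_smult op_poly_pCons) simp
  then have *: "T (op_poly T q v) = z *\<^sub>f op_poly T q v"
    using Suc.prems(4) by (simp add: cfun.scale_minus_left)
  show ?case
  proof (cases "op_poly T q v = 0")
    case True
    have "Polynomial.degree p = Suc (Polynomial.degree q)"
      unfolding p using q by (subst degree_mult_eq) auto
    then show ?thesis
      using Suc True q by auto
  next
    case False
    then show ?thesis
      using * op_poly_closed Suc.prems by blast
  qed
qed

text \<open>The iterates of \<open>v\<close> lie in a finite-dimensional space; the coefficients of
  a linear relation among them form a polynomial that annihilates \<open>v\<close>.\<close>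

lemma exists_eigenvector:
  assumes v: "v \<in> A" "v \<noteq> 0"
  shows "\<exists>\<mu> w. w \<in> A \<and> w \<noteq> 0 \<and> T w = \<mu> *\<^sub>f w"
proof -
  have pow: "(T ^^ n) v \<in> A" for n
    using v by (induction n) (auto intro: T_closed)
  show ?thesis
  \<comment> \<open>Dependence concerns the set of iterates, where repetitions merge. If all
    iterates differ, the set is infinite and hence dependent; a repetition gives the polynomial X^i
    - X^j instead.\<close>
  proof (cases "inj (\<lambda>n. (T ^^ n) v)")
    case True
    then have "infinite (range (\<lambda>n. (T ^^ n) v))"
      using finite_imageD by blast
    then have "cfun.dependent (range (\<lambda>n. (T ^^ n) v))"
      using independent_finite_card[of "range (\<lambda>n. (T ^^ n) v)"] pow by blast
    then obtain t u w where t: "finite t" "t \<subseteq> range (\<lambda>n. (T ^^ n) v)"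
      "(\<Sum>w\<in>t. u w *\<^sub>f w) = 0" "w \<in> t" "u w \<noteq> 0"
      unfolding cfun.dependent_explicit by blast
    obtain I where I: "t = (\<lambda>n. (T ^^ n) v) ` I" "finite I"
      using t(1,2) finite_subset_image by blast
    obtain m where m: "m \<in> I" "w = (T ^^ m) v"
      using t(4) I by blast
    define p where "p = (\<Sum>i\<in>I. Polynomial.monom (u ((T ^^ i) v)) i)"
    have "op_poly T p v = (\<Sum>i\<in>I. u ((T ^^ i) v) *\<^sub>f (T ^^ i) v)"
      unfolding p_def using v by (simp add: op_poly_sum op_poly_monom)
    also have "\<dots> = (\<Sum>w\<in>t. u w *\<^sub>f w)"
      unfolding I(1) using True by (subst sum.reindex) (auto simp: inj_on_def)
    finally have "op_poly T p v = 0"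
      using t by simp
    \<comment> \<open>This coefficient certifies that \<open>p\<close> is not the zero
      polynomial.\<close>
    moreover have "Polynomial.coeff p m = u w"
      unfolding p_def coeff_sum using I m by (simp add: when_def)
    ultimately show ?thesis
      using annihilating_poly_eigenvector[OF v, of p] t by force
  next
    case False
    then obtain i j where ij: "i \<noteq> j" "(T ^^ i) v = (T ^^ j) v"
      by (auto simp: inj_def)
    define p :: "complex poly" where "p = Polynomial.monom 1 i + Polynomial.monom (- 1) j"
    have "op_poly T p v = 0"
      unfolding p_def using v ij by (simp add: op_poly_add op_poly_monom)
    moreover have "Polynomial.coeff p i = 1"
      unfolding p_def using ij by simp
    ultimately show ?thesis
      using annihilating_poly_eigenvector[OF v, of p] by force
  qed
qed

end

section \<open>Hermitian operators: eigenbasis and trace\<close>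

locale hermitian_operator = finite_operator +
  assumes hermitian: "f \<in> A \<Longrightarrow> h \<in> A \<Longrightarrow> finner S (T f) h = finner S f (T h)"
begin

lemma eigenvalue_real:
  assumes "f \<in> A" "f \<noteq> 0" "T f = \<mu> *\<^sub>f f"
  shows "cnj \<mu> = \<mu>"
proof -
  have "cnj \<mu> * finner S f f = \<mu> * finner S f f"
    using hermitian[OF assms(1,1)] unfolding assms(3) finner_scale_left finner_scale_right .
  then show ?thesis
    using finner_self_eq_0[OF assms(1)] assms(2) by auto
qed

theorem eigenbasis:
  obtains B l where "onb B" "\<And>b. b \<in> B \<Longrightarrow> T b = l b *\<^sub>f b"
proof -
  \<comment> \<open>Eigenvectors for all eigenvalues at once, together with zero: closed under
    scaling, but in general not under addition.\<close>
  define V where "V = {f \<in> A. \<exists>\<mu>. T f = \<mu> *\<^sub>f f}"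
  have scale: "c *\<^sub>f f \<in> V" if "f \<in> V" for c f
    using that by (auto simp: V_def T_scale cfun.subspace_scale[OF subsp] mult.commute)
  have "V \<subseteq> A"
    by (auto simp: V_def)
  from maximal_orthonormal[OF this scale] obtain B where B: "B \<subseteq> V" "orthonormal S B"
    and max: "\<And>f. f \<in> V \<Longrightarrow> (\<And>b. b \<in> B \<Longrightarrow> finner S b f = 0) \<Longrightarrow> f = 0"
    by blast
  have BA: "B \<subseteq> A"
    using B by (auto simp: V_def)
  have "\<forall>b\<in>B. \<exists>\<mu>. T b = \<mu> *\<^sub>f b"
    using B(1) by (auto simp: V_def)
  from bchoice[OF this] obtain l where l: "\<And>b. b \<in> B \<Longrightarrow> T b = l b *\<^sub>f b"
    by blast
  define C where "C = {f \<in> A. \<forall>b\<in>B. finner S b f = 0}"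
  \<comment> \<open>The orthogonal complement of the eigenvectors is invariant, so it would contain another one.\<close>
  interpret C: finite_operator S C T
  proof
    show "cfun.subspace C"
      unfolding C_def using subsp
      by (auto simp: cfun.subspace_def finner_add_right finner_scale_right)
    show "T f \<in> C" if "f \<in> C" for f
      using that BA l hermitian[of _ f, symmetric]
      by (auto simp: C_def T_closed finner_scale_left subset_iff)
  qed (auto simp: C_def finite_S supp T_add T_scale)
  have "onb B"
  proof (rule onbI[OF BA B(2)], rule ccontr)
    fix f
    assume "f \<in> A" "\<And>b. b \<in> B \<Longrightarrow> finner S b f = 0" "f \<noteq> 0"
    then obtain \<mu> w where "w \<in> C" "w \<noteq> 0" "T w = \<mu> *\<^sub>f w"
      using C.exists_eigenvector[of f] by (auto simp: C_def)
    then show False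
      using max[of w] by (auto simp: C_def V_def)
  qed
  with l show ?thesis
    using that by blast
qed

text \<open>In an orthonormal eigenbasis the numerator of \<open>mean_eigenvalue\<close> is the
  trace and the denominator the dimension. Basis independence of the trace then allows a basis
  chosen without regard to \<open>T\<close>, so that one basis can serve many operators. If
  \<open>A\<close> is zero, both sides are 0 / 0 = 0.\<close>

theorem mean_eigenvalue_trace:
  assumes B': "onb B'"
  shows "mean_eigenvalue T A = (\<Sum>b\<in>B'. finner S b (T b)) / of_nat (card B')"
proof -
  obtain B l where B: "onb B" and l: "\<And>b. b \<in> B \<Longrightarrow> T b = l b *\<^sub>f b"
    using eigenbasis by blast
  have fin: "finite B" and BA: "B \<subseteq> A" and on: "orthonormal S B"
    using B onb_finite onb_subset onb_orthonormal by auto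
  have bb: "finner S b b = 1" if "b \<in> B" for b
    using on that by (auto simp: orthonormal_def)
  then have nz: "b \<noteq> 0" if "b \<in> B" for b
    using that finner_zero_right by (metis zero_neq_one)
  define E where "E \<mu> = {b \<in> B. l b = \<mu>}" for \<mu>
  \<comment> \<open>Eigenvalues are real, so eigenvectors for different eigenvalues are orthogonal;
    only the basis vectors in \<open>E \<mu>\<close> contribute, and they span the
    eigenspace.\<close>
  have exp: "(\<Sum>b\<in>E \<mu>. finner S b f *\<^sub>f b) = f" if f: "f \<in> A" "T f = \<mu> *\<^sub>f f" for f \<mu>
  proof -
    have "finner S b f = 0" if b: "b \<in> B" "l b \<noteq> \<mu>" for b
    proof -
      have "l b * finner S b f = finner S (T b) f"
        using eigenvalue_real[of b "l b"] b l nz BA by (auto simp: finner_scale_left)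
      also have "\<dots> = \<mu> * finner S b f"
        using hermitian[of b f] b BA f by (auto simp: finner_scale_right)
      finally show ?thesis
        using b by simp
    qed
    then have "(\<Sum>b\<in>B. finner S b f *\<^sub>f b) = (\<Sum>b\<in>E \<mu>. finner S b f *\<^sub>f b)"
      by (intro sum.mono_neutral_right fin) (auto simp: E_def)
    then show ?thesis
      using onb_expand[OF B f(1)] by simp
  qed
  have E_sub: "E \<mu> \<subseteq> eigenspace_on T A \<mu>" for \<mu>
    using BA l by (auto simp: E_def eigenspace_on_def)
  have dim: "cfun.dim (eigenspace_on T A \<mu>) = card (E \<mu>)" for \<mu>
  proof (rule cfun.dim_unique)
    show "eigenspace_on T A \<mu> \<subseteq> cfun.span (E \<mu>)"
    proof
      fix f assume "f \<in> eigenspace_on T A \<mu>"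
      then have "(\<Sum>b\<in>E \<mu>. finner S b f *\<^sub>f b) = f"
        by (intro exp) (auto simp: eigenspace_on_def)
      then show "f \<in> cfun.span (E \<mu>)"
        using sum_in_span[of "\<lambda>b. finner S b f" "E \<mu>"] by simp
    qed
    show "cfun.independent (E \<mu>)"
      by (rule orthonormal_independent[OF orthonormal_subset[OF on]]) (auto simp: E_def)
  qed (use E_sub in auto)
  have ev: "eigenvalues_on T A = l ` B"
  proof (intro equalityI subsetI)
    fix \<mu> assume "\<mu> \<in> eigenvalues_on T A"
    then obtain f where "f \<in> A" "T f = \<mu> *\<^sub>f f" "f \<noteq> 0"
      by (auto simp: eigenvalues_on_def eigenspace_on_def)
    with exp[of f \<mu>] have "E \<mu> \<noteq> {}"
      by fastforce
    then show "\<mu> \<in> l ` B"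
      by (auto simp: E_def)
  next
    fix \<mu> assume "\<mu> \<in> l ` B"
    then show "\<mu> \<in> eigenvalues_on T A"
      using E_sub[of \<mu>] nz by (force simp: eigenvalues_on_def E_def)
  qed
  have group: "(\<Sum>\<mu>\<in>l ` B. \<Sum>b\<in>E \<mu>. g b) = (\<Sum>b\<in>B. g b)" for g :: "_ \<Rightarrow> complex"
    unfolding E_def by (rule sum.group) (use fin in auto)
  have num: "of_nat (card (E \<mu>)) * \<mu> = (\<Sum>b\<in>E \<mu>. finner S b (T b))" for \<mu>
  proof -
    have "(\<Sum>b\<in>E \<mu>. finner S b (T b)) = (\<Sum>b\<in>E \<mu>. \<mu>)"
      using l bb by (intro sum.cong) (auto simp: E_def finner_scale_right)
    then show ?thesis
      by simp
  qed
  have "mean_eigenvalue T A = (\<Sum>b\<in>B. finner S b (T b)) / of_nat (card B)"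
    unfolding mean_eigenvalue_def ev dim num using group[of "\<lambda>b. 1"]
    by (simp add: group)
  moreover have "card B = card B'"
    using dim_onb[OF B] dim_onb[OF B'] by simp
  moreover have "(\<Sum>b\<in>B. finner S b (T b)) = (\<Sum>b\<in>B'. finner S b (T b))"
  proof -
    \<comment> \<open>With \<open>T c\<close> expanded through the eigenbasis, \<open>C\<close>
      enters only through a sum over \<open>c\<close> that \<open>coeff\<close> evaluates to
      \<open>cnj (b x)\<close>, whatever \<open>C\<close> is.\<close>
    have trace: "(\<Sum>c\<in>C. finner S c (T c)) =
        (\<Sum>x\<in>S. \<Sum>b\<in>B. (\<Sum>c\<in>C. finner S b c * T b x * cnj (c x)))"
      if C: "onb C" for C
    proof -
      have Tc: "T c x = (\<Sum>b\<in>B. finner S b c * T b x)" if "c \<in> C" for c x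
      proof -
        have "c \<in> A"
          using onb_subset[OF C] that by auto
        then have "T c = (\<Sum>b\<in>B. finner S b c *\<^sub>f T b)"
          using T_sum[OF fin, of "\<lambda>b. b" "\<lambda>b. finner S b c"] BA onb_expand[OF B]
          by (simp add: subset_iff)
        then show ?thesis
          by (simp add: sum_fun_apply fscale_def)
      qed
      have "(\<Sum>c\<in>C. finner S c (T c)) =
          (\<Sum>c\<in>C. \<Sum>x\<in>S. \<Sum>b\<in>B. finner S b c * T b x * cnj (c x))"
        unfolding finner_def[of S _ "T _"]
        by (intro sum.cong refl) (simp add: Tc sum_distrib_left mult_ac)
      also have "\<dots> = (\<Sum>x\<in>S. \<Sum>c\<in>C. \<Sum>b\<in>B. finner S b c * T b x * cnj (c x))"
        by (rule sum.swap)
      also have "\<dots> = (\<Sum>x\<in>S. \<Sum>b\<in>B. \<Sum>c\<in>C. finner S b c * T b x * cnj (c x))"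
        by (intro sum.cong refl sum.swap)
      finally show ?thesis
        by simp
    qed
    have coeff: "(\<Sum>c\<in>C. finner S b c * cnj (c x)) = cnj (b x)" if "onb C" "b \<in> B" for C b x
      using arg_cong[OF onb_expand[OF that(1), of b], of "\<lambda>f. cnj (f x)"] that BA
      by (auto simp: sum_fun_apply fscale_def cnj_finner)
    have "(\<Sum>c\<in>C. finner S b c * T b x * cnj (c x)) = T b x * cnj (b x)"
      if "onb C" "b \<in> B" for C b x
    proof -
      have "(\<Sum>c\<in>C. finner S b c * T b x * cnj (c x)) =
          T b x * (\<Sum>c\<in>C. finner S b c * cnj (c x))"
        by (simp add: sum_distrib_left mult_ac)
      then show ?thesis
        using coeff[OF that] by simp
    qed
    then show ?thesis
      using trace[OF B] trace[OF B'] B B' by simp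
  qed
  ultimately show ?thesis
    by simp
qed

end

subsection \<open>Convolution operators on translation-invariant spaces\<close>

definition right_translation ::
    "('a, 'b) monoid_scheme \<Rightarrow> 'a \<Rightarrow> ('a \<Rightarrow> complex) \<Rightarrow> 'a \<Rightarrow> complex"
  where "right_translation G t f = restr G (\<lambda>g. f (g \<otimes>\<^bsub>G\<^esub> t))"

text \<open>Convolution with the reflected kernel, written through right translations so that traces
  become sums over \<open>s\<close>. Real values suffice because admissible operators turn out to
  have real kernels.\<close>

definition conv ::
    "('a, 'b) monoid_scheme \<Rightarrow> ('a \<Rightarrow> real) \<Rightarrow> ('a \<Rightarrow> complex) \<Rightarrow> 'a \<Rightarrow> complex"
  where "conv G k f = (\<Sum>s\<in>carrier G. complex_of_real (k s) *\<^sub>f right_translation G s f)"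

lemma conv_apply:
  "conv G k f g = (if g \<in> carrier G
    then \<Sum>s\<in>carrier G. complex_of_real (k s) * f (g \<otimes>\<^bsub>G\<^esub> s) else 0)"
  by (simp add: conv_def sum_fun_apply fscale_def right_translation_def restr_def)

section \<open>Translations on a finite group\<close>

locale finite_grp = group G for G (structure) +
  assumes finite_carrier: "finite (carrier G)"
begin

lemma bij_right_mult:
  assumes "t \<in> carrier G"
  shows "bij_betw (\<lambda>x. x \<otimes> t) (carrier G) (carrier G)"
  by (rule bij_betwI[where g = "\<lambda>x. x \<otimes> inv t"]) (use assms in \<open>auto simp: m_assoc\<close>)

lemma bij_left_mult:
  assumes "t \<in> carrier G"
  shows "bij_betw (\<lambda>x. t \<otimes> x) (carrier G) (carrier G)"
  by (rule bij_betwI[where g = "\<lambda>x. inv t \<otimes> x"])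
    (use assms in \<open>auto simp flip: m_assoc\<close>)

lemma bij_inv: "bij_betw (\<lambda>x. inv x) (carrier G) (carrier G)"
  by (rule bij_betwI[where g = "\<lambda>x. inv x"]) auto

lemma sum_right_mult:
  "t \<in> carrier G \<Longrightarrow> (\<Sum>x\<in>carrier G. h (x \<otimes> t)) = (\<Sum>x\<in>carrier G. h x :: complex)"
  by (rule sum.reindex_bij_betw[OF bij_right_mult])

lemma sum_inv: "(\<Sum>x\<in>carrier G. h (inv x)) = (\<Sum>x\<in>carrier G. h x :: complex)"
  by (rule sum.reindex_bij_betw[OF bij_inv])

lemma finner_right_translation:
  assumes "t \<in> carrier G"
  shows "finner (carrier G) (right_translation G t f) (right_translation G t h) =
    finner (carrier G) f h"
  unfolding finner_def right_translation_def restr_def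
  using sum_right_mult[OF assms, of "\<lambda>x. cnj (f x) * h x"] by simp

lemma right_translation_inverse:
  assumes "t \<in> carrier G" "\<And>x. x \<notin> carrier G \<Longrightarrow> f x = 0"
  shows "right_translation G (inv t) (right_translation G t f) = f"
    and "right_translation G t (right_translation G (inv t) f) = f"
  using assms by (auto simp: right_translation_def restr_def fun_eq_iff m_assoc)

end

section \<open>Traces of translations on a right-invariant space\<close>

locale right_invariant_space = finite_grp G + finite_subspace "carrier G" A
  for G :: "('a, 'b) monoid_scheme" (structure) and A +
  assumes right_translation_closed:
    "t \<in> carrier G \<Longrightarrow> f \<in> A \<Longrightarrow> right_translation G t f \<in> A"
begin

lemma right_translation_inj:
  assumes "t \<in> carrier G"
  shows "inj_on (right_translation G t) A"
  by (rule inj_on_inverseI[where g = "right_translation G (inv t)"])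
    (use assms right_translation_inverse(1) supp in blast)

text \<open>Right translation by \<open>t\<close> is a unitary map of \<open>A\<close> onto itself.
  For completeness, a vector orthogonal to the image is pulled back by \<open>inv t\<close> to one
  orthogonal to \<open>B\<close>.\<close>

lemma onb_right_translation:
  assumes B: "onb B" and t: "t \<in> carrier G"
  shows "onb (right_translation G t ` B)"
proof (rule onbI)
  have BA: "B \<subseteq> A"
    using B by (rule onb_subset)
  then show "right_translation G t ` B \<subseteq> A"
    using right_translation_closed t by auto
  have "right_translation G t b = right_translation G t c \<longleftrightarrow> b = c" if "b \<in> B" "c \<in> B" for b c
    using right_translation_inj[OF t] that BA unfolding inj_on_def by blast
  then show "orthonormal (carrier G) (right_translation G t ` B)"
    using onb_orthonormal[OF B] t by (simp add: orthonormal_def finner_right_translation)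
  fix f
  assume f: "f \<in> A"
    "\<And>b. b \<in> right_translation G t ` B \<Longrightarrow> finner (carrier G) b f = 0"
  define h where "h = right_translation G (inv t) f"
  have hA: "h \<in> A" and h: "right_translation G t h = f"
    using f t supp right_translation_inverse(2)[OF t] right_translation_closed
    by (auto simp: h_def)
  have "finner (carrier G) b h = 0" if "b \<in> B" for b
    using f(2)[of "right_translation G t b"] that t finner_right_translation[of t b h] h by auto
  then have "h = 0"
    using onb_expand[OF B hA] by (simp add: sum.neutral)
  then show "f = 0"
    using h by (auto simp: right_translation_def restr_def)
qed

text \<open>The left side is the projection kernel computed from the translated basis, so
  \<open>onb_kernel_unique\<close> applies.\<close>

lemma onb_kernel_invariant:
  assumes B: "onb B" and "t \<in> carrier G" "x \<in> carrier G" "y \<in> carrier G"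
  shows "(\<Sum>b\<in>B. b (x \<otimes> t) * cnj (b (y \<otimes> t))) = (\<Sum>b\<in>B. b x * cnj (b y))"
proof -
  have "inj_on (right_translation G t) B"
    using right_translation_inj[OF assms(2)] onb_subset[OF B] inj_on_subset by blast
  then have "(\<Sum>b\<in>right_translation G t ` B. b x * cnj (b y)) =
      (\<Sum>b\<in>B. b (x \<otimes> t) * cnj (b (y \<otimes> t)))"
    using assms by (subst sum.reindex) (simp_all add: right_translation_def restr_def)
  then show ?thesis
    using onb_kernel_unique[OF B onb_right_translation[OF B assms(2)]] by simp
qed

definition trace_translation :: "('a \<Rightarrow> complex) set \<Rightarrow> 'a \<Rightarrow> complex"
  where "trace_translation B s = (\<Sum>b\<in>B. finner (carrier G) b (right_translation G s b))"

text \<open>The trace sums the projection kernel over the pairs (x s, x). Translating both entries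
  by \<open>t\<close> turns the pair for \<open>t \<otimes> s \<otimes> inv t\<close> into (x t s, x
  t), and x t again runs over the group.\<close>

lemma trace_translation_conj:
  assumes B: "onb B" and t: "t \<in> carrier G" and s: "s \<in> carrier G"
  shows "trace_translation B (t \<otimes> s \<otimes> inv t) = trace_translation B s"
proof -
  have tr: "trace_translation B u =
      (\<Sum>x\<in>carrier G. \<Sum>b\<in>B. b (x \<otimes> u) * cnj (b x))" for u
    unfolding trace_translation_def finner_def right_translation_def restr_def
    by (subst sum.swap) (simp add: mult.commute)
  have "(\<Sum>b\<in>B. b (x \<otimes> (t \<otimes> s \<otimes> inv t)) * cnj (b x)) =
      (\<Sum>b\<in>B. b (x \<otimes> t \<otimes> s) * cnj (b (x \<otimes> t)))" if x: "x \<in> carrier G" for x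
  proof -
    have "x \<otimes> (t \<otimes> s \<otimes> inv t) \<otimes> t = x \<otimes> t \<otimes> s"
      using x s t by (simp add: m_assoc)
    then show ?thesis
      using onb_kernel_invariant[OF B t, of "x \<otimes> (t \<otimes> s \<otimes> inv t)" x] x s t by simp
  qed
  then show ?thesis
    unfolding tr using sum_right_mult[OF t, of "\<lambda>x. \<Sum>b\<in>B. b (x \<otimes> s) * cnj (b x)"] by simp
qed

text \<open>The adjoint of right translation by \<open>s\<close> is translation by
  \<open>inv s\<close>, so a real kernel invariant under inversion is self-adjoint. Agreement with
  \<open>conv\<close> is asked only on \<open>A\<close>, since \<open>laplacian\<close> differs from
  a convolution outside \<open>L2\<close>.\<close>

lemma hermitian_conv:
  assumes k: "\<And>s. s \<in> carrier G \<Longrightarrow> k (inv s) = k s"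
    and T: "\<And>f. f \<in> A \<Longrightarrow> T f = conv G k f"
  shows "hermitian_operator (carrier G) A T"
proof
  show "T f \<in> A" if "f \<in> A" for f
    unfolding T[OF that] conv_def
    using that by (intro cfun.subspace_sum cfun.subspace_scale subsp right_translation_closed)
  show "T (f + h) = T f + T h" if "f \<in> A" "h \<in> A" for f h
    using that cfun.subspace_add[OF subsp that]
    by (auto simp: T conv_apply fun_eq_iff algebra_simps sum.distrib)
  show "T (c *\<^sub>f f) = c *\<^sub>f T f" if "f \<in> A" for f c
    using that cfun.subspace_scale[OF subsp that]
    by (auto simp: T conv_apply fun_eq_iff fscale_def sum_distrib_left algebra_simps)
  show "finner (carrier G) (T f) h = finner (carrier G) f (T h)" if "f \<in> A" "h \<in> A" for f h
  proof -
    have "finner (carrier G) (T f) h =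
        (\<Sum>x\<in>carrier G. \<Sum>s\<in>carrier G. complex_of_real (k s) * cnj (f (x \<otimes> s)) * h x)"
      using that by (simp add: finner_def T conv_apply sum_distrib_right)
    also have "\<dots> = (\<Sum>s\<in>carrier G. \<Sum>x\<in>carrier G. complex_of_real (k s) * cnj (f (x \<otimes> s)) * h x)"
      by (rule sum.swap)
    also have "\<dots> = (\<Sum>s\<in>carrier G. \<Sum>x\<in>carrier G. complex_of_real (k s) * cnj (f x) * h (x \<otimes> inv s))"
    proof (rule sum.cong[OF refl])
      fix s assume s: "s \<in> carrier G"
      show "(\<Sum>x\<in>carrier G. complex_of_real (k s) * cnj (f (x \<otimes> s)) * h x) =
          (\<Sum>x\<in>carrier G. complex_of_real (k s) * cnj (f x) * h (x \<otimes> inv s))"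
        using sum_right_mult[OF s, of "\<lambda>x. complex_of_real (k s) * cnj (f x) * h (x \<otimes> inv s)"] s
        by (simp add: m_assoc)
    qed
    also have "\<dots> = (\<Sum>s\<in>carrier G. \<Sum>x\<in>carrier G. complex_of_real (k s) * cnj (f x) * h (x \<otimes> s))"
      by (subst sum_inv[symmetric]) (simp add: k)
    also have "\<dots> = (\<Sum>x\<in>carrier G. \<Sum>s\<in>carrier G. complex_of_real (k s) * cnj (f x) * h (x \<otimes> s))"
      by (rule sum.swap)
    also have "\<dots> = finner (carrier G) f (T h)"
      using that by (simp add: finner_def T conv_apply sum_distrib_left mult_ac)
    finally show ?thesis .
  qed
qed

lemma mean_eigenvalue_conv:
  assumes B: "onb B" and k: "\<And>s. s \<in> carrier G \<Longrightarrow> k (inv s) = k s"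
    and T: "\<And>f. f \<in> A \<Longrightarrow> T f = conv G k f"
  shows "mean_eigenvalue T A =
    (\<Sum>s\<in>carrier G. complex_of_real (k s) * trace_translation B s) / of_nat (card B)"
proof -
  interpret hermitian_operator "carrier G" A T
    using k T by (rule hermitian_conv)
  have "(\<Sum>b\<in>B. finner (carrier G) b (T b)) =
      (\<Sum>b\<in>B. \<Sum>s\<in>carrier G. complex_of_real (k s) * finner (carrier G) b (right_translation G s b))"
    using onb_subset[OF B]
    by (intro sum.cong) (auto simp: T conv_def finner_sum_right finner_scale_right)
  also have "\<dots> = (\<Sum>s\<in>carrier G. complex_of_real (k s) * trace_translation B s)"
    unfolding trace_translation_def sum_distrib_left by (rule sum.swap)
  finally show ?thesis
    using mean_eigenvalue_trace[OF B] by simp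
qed

text \<open>Only kernels invariant under inversion matter, so the trace may be symmetrized; this makes it
  constant on each \<open>C \<union> C\<^sup>-\<^sup>1\<close> and not merely on \<open>C\<close>.\<close>

lemma mean_eigenvalue_class_function:
  obtains \<psi> D where
    "\<And>s t. s \<in> carrier G \<Longrightarrow> t \<in> carrier G \<Longrightarrow> \<psi> (t \<otimes> s \<otimes> inv t) = \<psi> s"
    "\<And>s. s \<in> carrier G \<Longrightarrow> \<psi> (inv s) = \<psi> s"
    "\<And>k T. (\<And>s. s \<in> carrier G \<Longrightarrow> k (inv s) = k s) \<Longrightarrow> (\<And>f. f \<in> A \<Longrightarrow> T f = conv G k f) \<Longrightarrow>
       mean_eigenvalue T A = (\<Sum>s\<in>carrier G. complex_of_real (k s) * \<psi> s) / D"
proof -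
  obtain B where B: "onb B"
    by (rule obtain_onb)
  define \<phi> where "\<phi> = trace_translation B"
  define \<psi> where "\<psi> s = (\<phi> s + \<phi> (inv s)) / 2" for s
  have \<phi>: "\<phi> (t \<otimes> s \<otimes> inv t) = \<phi> s" if "s \<in> carrier G" "t \<in> carrier G" for s t
    unfolding \<phi>_def using trace_translation_conj[OF B] that by simp
  show ?thesis
  proof (rule that[of \<psi> "of_nat (card B)"])
    fix s t assume "s \<in> carrier G" "t \<in> carrier G"
    then show "\<psi> (t \<otimes> s \<otimes> inv t) = \<psi> s"
      using \<phi>[of s t] \<phi>[of "inv s" t] by (simp add: \<psi>_def inv_mult_group m_assoc)
  next
    fix s assume "s \<in> carrier G"
    then show "\<psi> (inv s) = \<psi> s"
      by (simp add: \<psi>_def add.commute)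
  next
    fix k T
    assume k: "\<And>s. s \<in> carrier G \<Longrightarrow> k (inv s) = k s"
      and T: "\<And>f. f \<in> A \<Longrightarrow> T f = conv G k f"
    have "(\<Sum>s\<in>carrier G. complex_of_real (k s) * \<phi> (inv s)) =
        (\<Sum>s\<in>carrier G. complex_of_real (k s) * \<phi> s)"
      using sum_inv[of "\<lambda>s. complex_of_real (k s) * \<phi> s"] k by simp
    then have "(\<Sum>s\<in>carrier G. complex_of_real (k s) * \<psi> s) =
        (\<Sum>s\<in>carrier G. complex_of_real (k s) * \<phi> s)"
      by (simp add: \<psi>_def distrib_left sum.distrib flip: sum_divide_distrib)
    then show "mean_eigenvalue T A =
        (\<Sum>s\<in>carrier G. complex_of_real (k s) * \<psi> s) / of_nat (card B)"
      using mean_eigenvalue_conv[OF B k T] by (simp add: \<phi>_def)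
  qed
qed

end

subsection \<open>Matrix coefficients\<close>

text \<open>By multiplicativity of \<open>\<sigma>\<close>, right translation by \<open>t\<close>
  sends the entry (i, j) to a combination of entries of row i, with column j of
  \<open>\<sigma> t\<close> as coefficients.\<close>

lemma (in finite_grp) right_invariant_coeff_space:
  assumes "matrix_rep G \<sigma>"
  shows "right_invariant_space G (coeff_space G \<sigma>)"
proof -
  define d where "d = rep_dim G \<sigma>"
  define c where "c i j = restr G (\<lambda>g. \<sigma> g $$ (i, j))" for i j
  have A: "coeff_space G \<sigma> = cfun.span {c i j | i j. i < d \<and> j < d}"
    by (simp add: coeff_space_def c_def d_def)
  have hom: "\<sigma> \<in> hom G (GL_complex d)"
    using assms by (simp add: matrix_rep_def d_def)
  have car: "\<sigma> g \<in> carrier_mat d d" if "g \<in> carrier G" for g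
    using hom that by (auto simp: hom_def units_of_def Units_def ring_mat_simps)
  have mult: "\<sigma> (g \<otimes> h) = \<sigma> g * \<sigma> h" if "g \<in> carrier G" "h \<in> carrier G" for g h
    using hom that by (auto simp: hom_def units_of_def ring_mat_simps)
  show ?thesis
  proof
    show "finite (carrier G)"
      by (rule finite_carrier)
    show "cfun.subspace (coeff_space G \<sigma>)"
      unfolding coeff_space_def by (rule cfun.subspace_span)
    show "f x = 0" if "f \<in> coeff_space G \<sigma>" "x \<notin> carrier G" for f x
      using that(1) unfolding A
      by (induction rule: cfun.span_induct_alt)
        (use that(2) in \<open>auto simp: c_def restr_def fscale_def\<close>)
    show "right_translation G t f \<in> coeff_space G \<sigma>" if t: "t \<in> carrier G"
      and f: "f \<in> coeff_space G \<sigma>" for t f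
      using f unfolding A
    proof (induction rule: cfun.span_induct_alt)
      case base
      have "right_translation G t 0 = 0"
        by (auto simp: right_translation_def restr_def)
      then show ?case
        by (simp only: cfun.span_zero)
    next
      case (step a x y)
      then obtain i j where ij: "x = c i j" "i < d" "j < d"
        by blast
      have "right_translation G t x = (\<Sum>l<d. \<sigma> t $$ (l, j) *\<^sub>f c i l)"
      proof
        fix g
        show "right_translation G t x g = (\<Sum>l<d. \<sigma> t $$ (l, j) *\<^sub>f c i l) g"
        proof (cases "g \<in> carrier G")
          case True
          have "(\<sigma> g * \<sigma> t) $$ (i, j) = (\<Sum>l<d. \<sigma> g $$ (i, l) * \<sigma> t $$ (l, j))"
            using car[OF True] car[OF t] ij
            by (simp add: scalar_prod_def atLeast0LessThan)
          with True t show ?thesis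
            by (simp add: ij(1) right_translation_def restr_def c_def mult sum_fun_apply
                fscale_def mult.commute)
        qed (simp add: right_translation_def restr_def c_def sum_fun_apply fscale_def)
      qed
      also have "\<dots> \<in> cfun.span {c i j | i j. i < d \<and> j < d}"
        using ij by (intro cfun.span_sum cfun.span_scale cfun.span_base) auto
      finally have "a *\<^sub>f right_translation G t x + right_translation G t y \<in>
          cfun.span {c i j | i j. i < d \<and> j < d}"
        using step by (intro cfun.span_add cfun.span_scale)
      moreover have "right_translation G t (a *\<^sub>f x + y) =
          a *\<^sub>f right_translation G t x + right_translation G t y"
        by (auto simp: right_translation_def restr_def fscale_def)
      ultimately show ?case
        by (simp only:)
    qed
  qed
qed

subsection \<open>Symmetrized conjugacy classes\<close>

context finite_grp
begin

text \<open>Conjugacy up to inversion. As an equivalence relation on the non-identity elements it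
  has the sets of \<open>sym_classes\<close> as its classes, and the theory of quotients then
  supplies the partition.\<close>

definition symrel :: "('a \<times> 'a) set"
  where "symrel = {(x, y). x \<in> carrier G - {\<one>} \<and> y \<in> carrier G - {\<one>} \<and>
    (\<exists>g\<in>carrier G. y = g \<otimes> x \<otimes> inv g \<or> y = inv (g \<otimes> x \<otimes> inv g))}"

lemma conj_eq_one_iff:
  "g \<in> carrier G \<Longrightarrow> x \<in> carrier G \<Longrightarrow> g \<otimes> x \<otimes> inv g = \<one> \<longleftrightarrow> x = \<one>"
  by (metis inv_closed inv_equality inv_inv l_cancel_one' m_assoc m_closed r_inv)

lemma inv_conj:
  "g \<in> carrier G \<Longrightarrow> x \<in> carrier G \<Longrightarrow> inv (g \<otimes> x \<otimes> inv g) = g \<otimes> inv x \<otimes> inv g"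
  by (simp add: inv_mult_group m_assoc)

lemma symrel_refl:
  assumes "x \<in> carrier G - {\<one>}"
  shows "(x, x) \<in> symrel"
  using assms by (auto simp: symrel_def intro!: bexI[of _ \<one>])

lemma symrel_inv: "x \<in> carrier G - {\<one>} \<Longrightarrow> (x, inv x) \<in> symrel"
  by (auto simp: symrel_def intro!: bexI[of _ \<one>])

lemma symrel_sym:
  assumes "(x, y) \<in> symrel"
  shows "(y, x) \<in> symrel"
proof -
  obtain g where g: "g \<in> carrier G" "x \<in> carrier G" "y \<in> carrier G" "x \<noteq> \<one>" "y \<noteq> \<one>"
    and y: "y = g \<otimes> x \<otimes> inv g \<or> y = g \<otimes> inv x \<otimes> inv g"
    using assms by (auto simp: symrel_def inv_conj)
  have *: "inv g \<otimes> (g \<otimes> z \<otimes> inv g) \<otimes> inv (inv g) = z" if "z \<in> carrier G" for z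
    using g(1) that by (simp add: m_assoc) (simp add: m_assoc[symmetric])
  have "x = inv g \<otimes> y \<otimes> inv (inv g) \<or> inv x = inv g \<otimes> y \<otimes> inv (inv g)"
    using y *[of x] *[of "inv x"] g(2) by auto
  then have "x = inv g \<otimes> y \<otimes> inv (inv g) \<or> x = inv (inv g \<otimes> y \<otimes> inv (inv g))"
    using g by (metis inv_inv)
  with g show ?thesis
    by (auto simp: symrel_def intro!: bexI[of _ "inv g"])
qed

lemma symrel_trans:
  assumes "(x, y) \<in> symrel" "(y, z) \<in> symrel"
  shows "(x, z) \<in> symrel"
proof -
  obtain g h where g: "g \<in> carrier G" "h \<in> carrier G" "x \<in> carrier G" "x \<noteq> \<one>" "z \<noteq> \<one>" "z \<in> carrier G"
    and y: "y = g \<otimes> x \<otimes> inv g \<or> y = g \<otimes> inv x \<otimes> inv g"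
    and z: "z = h \<otimes> y \<otimes> inv h \<or> z = h \<otimes> inv y \<otimes> inv h"
    using assms by (auto simp: symrel_def inv_conj)
  have *: "h \<otimes> (g \<otimes> u \<otimes> inv g) \<otimes> inv h = (h \<otimes> g) \<otimes> u \<otimes> inv (h \<otimes> g)" if "u \<in> carrier G" for u
    using g that by (simp add: m_assoc inv_mult_group)
  have "z = (h \<otimes> g) \<otimes> x \<otimes> inv (h \<otimes> g) \<or> z = (h \<otimes> g) \<otimes> inv x \<otimes> inv (h \<otimes> g)"
    using y z g by (auto simp: * inv_conj)
  with g show ?thesis
    by (auto simp: symrel_def inv_conj intro!: bexI[of _ "h \<otimes> g"])
qed

lemma equiv_symrel: "equiv (carrier G - {\<one>}) symrel"
proof (rule equivI)
  show "symrel \<subseteq> (carrier G - {\<one>}) \<times> (carrier G - {\<one>})"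
    by (auto simp: symrel_def)
  show "refl_on (carrier G - {\<one>}) symrel"
    using symrel_refl by (auto simp: refl_on_def)
  show "sym symrel"
    using symrel_sym by (rule symI)
  show "trans symrel"
    using symrel_trans by (rule transI)
qed

lemma conjugacy_class_eq:
  assumes "x \<in> carrier G - {\<one>}"
  shows "orbit G (\<lambda>g x. g \<otimes> x \<otimes> inv g) x \<union>
    set_inv (orbit G (\<lambda>g x. g \<otimes> x \<otimes> inv g) x) = symrel `` {x}"
  using assms by (auto simp: orbit_def SET_INV_def symrel_def conj_eq_one_iff inv_eq_1_iff)

lemma sym_classes_quotient: "sym_classes G = (carrier G - {\<one>}) // symrel"
proof -
  \<comment> \<open>Excluding the trivial class thus amounts to removing the identity from the set
    of representatives.\<close>
  have one: "orbit G (\<lambda>g x. g \<otimes> x \<otimes> inv g) x = {\<one>} \<longleftrightarrow> x = \<one>" if "x \<in> carrier G" for x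
  proof
    have "x \<in> orbit G (\<lambda>g x. g \<otimes> x \<otimes> inv g) x"
      using that by (force simp: orbit_def intro!: exI[of _ \<one>])
    then show "x = \<one>" if "orbit G (\<lambda>g x. g \<otimes> x \<otimes> inv g) x = {\<one>}"
      using that by simp
    show "orbit G (\<lambda>g x. g \<otimes> x \<otimes> inv g) x = {\<one>}" if "x = \<one>"
      using that by (auto simp: orbit_def intro!: exI[of _ \<one>])
  qed
  have "sym_classes G = (\<lambda>x. orbit G (\<lambda>g x. g \<otimes> x \<otimes> inv g) x \<union>
      set_inv (orbit G (\<lambda>g x. g \<otimes> x \<otimes> inv g) x)) ` (carrier G - {\<one>})"
    unfolding sym_classes_def conjugacy_classes_def orbits_def using one by auto
  also have "\<dots> = (\<lambda>x. symrel `` {x}) ` (carrier G - {\<one>})"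
    using conjugacy_class_eq by (rule image_cong[OF refl])
  finally show ?thesis
    by (auto simp: quotient_def)
qed

section \<open>The symmetrized classes as a partition\<close>

lemma Union_sym_classes: "\<Union>(sym_classes G) = carrier G - {\<one>}"
  unfolding sym_classes_quotient by (rule Union_quotient[OF equiv_symrel])

lemma sym_classes_disjoint:
  "K \<in> sym_classes G \<Longrightarrow> L \<in> sym_classes G \<Longrightarrow> s \<in> K \<Longrightarrow> s \<in> L \<Longrightarrow> K = L"
  using quotient_disj[OF equiv_symrel] unfolding sym_classes_quotient by blast

lemma finite_sym_classes: "finite (sym_classes G)"
  unfolding sym_classes_quotient
  using finite_quotient[of "carrier G - {\<one>}" symrel] finite_carrier
  by (auto simp: symrel_def)

lemma sym_classes_subset: "K \<in> sym_classes G \<Longrightarrow> K \<subseteq> carrier G - {\<one>}"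
  using Union_sym_classes by blast

lemma sym_class_finite: "K \<in> sym_classes G \<Longrightarrow> finite K"
  using finite_subset[OF sym_classes_subset] finite_carrier by blast

lemma sym_class_nonempty: "K \<in> sym_classes G \<Longrightarrow> K \<noteq> {}"
  unfolding sym_classes_quotient using in_quotient_imp_non_empty[OF equiv_symrel] .

lemma sym_class_inv:
  assumes K: "K \<in> sym_classes G" and s: "s \<in> carrier G"
  shows "inv s \<in> K \<longleftrightarrow> s \<in> K"
proof -
  have "inv x \<in> K" if "x \<in> K" for x
    using that K sym_classes_subset[OF K] symrel_inv[of x]
      in_quotient_imp_closed[OF equiv_symrel, of K x "inv x"]
    unfolding sym_classes_quotient by blast
  from this[of s] this[of "inv s"] s show ?thesis
    by auto
qed

lemma sum_sym_classes:
  "(\<Sum>s\<in>carrier G. h s) = h \<one> + (\<Sum>K\<in>sym_classes G. \<Sum>s\<in>K. h s :: 'c :: comm_monoid_add)"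
proof -
  have "(\<Sum>s\<in>carrier G. h s) = h \<one> + (\<Sum>s\<in>\<Union>(sym_classes G). h s)"
    unfolding Union_sym_classes using finite_carrier by (intro sum.remove) auto
  also have "(\<Sum>s\<in>\<Union>(sym_classes G). h s) = (\<Sum>K\<in>sym_classes G. \<Sum>s\<in>K. h s)"
    using sym_class_finite sym_classes_disjoint
    by (subst sum.Union_disjoint) (auto simp: disjoint_iff)
  finally show ?thesis .
qed

lemma class_function_const:
  assumes "\<And>s t. s \<in> carrier G \<Longrightarrow> t \<in> carrier G \<Longrightarrow> \<psi> (t \<otimes> s \<otimes> inv t) = \<psi> s"
    and "\<And>s. s \<in> carrier G \<Longrightarrow> \<psi> (inv s) = \<psi> s"
    and K: "K \<in> sym_classes G" "x \<in> K" "y \<in> K"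
  shows "\<psi> x = \<psi> y"
proof -
  have "(x, y) \<in> symrel"
    using K quotient_eq_iff[OF equiv_symrel, of K K x y] unfolding sym_classes_quotient by simp
  then show ?thesis
    using assms(1,2) by (auto simp: symrel_def)
qed

subsection \<open>Kernels of Laplacians and of admissible operators\<close>

definition laplacian_kernel :: "'a set \<Rightarrow> 'a \<Rightarrow> real"
  where "laplacian_kernel K s = (if s = \<one> then 1 else 0) - (if s \<in> K then 1 / real (card K) else 0)"

lemma sum_laplacian_kernel:
  assumes "K \<subseteq> carrier G"
  shows "(\<Sum>s\<in>carrier G. complex_of_real (laplacian_kernel K s) * h s) =
    h \<one> - 1 / of_nat (card K) * (\<Sum>s\<in>K. h s)"
proof -
  have "complex_of_real (laplacian_kernel K s) * h s =
      (if s = \<one> then h s else 0) - (if s \<in> K then 1 / of_nat (card K) * h s else 0)" for s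
    by (simp add: laplacian_kernel_def algebra_simps)
  moreover have "(\<Sum>s\<in>carrier G. if s \<in> K then 1 / of_nat (card K) * h s else 0) =
      (\<Sum>s\<in>K. 1 / of_nat (card K) * h s)"
    using assms finite_carrier by (simp add: sum.inter_restrict[symmetric] Int_absorb1)
  ultimately show ?thesis
    using finite_carrier by (simp add: sum_subtractf sum_distrib_left)
qed

lemma laplacian_eq_conv:
  assumes "K \<subseteq> carrier G" "f \<in> L2 G"
  shows "laplacian G K f = conv G (laplacian_kernel K) f"
  using assms(2)
  by (auto simp: fun_eq_iff conv_apply sum_laplacian_kernel[OF assms(1)] laplacian_def
      averaging_def restr_def L2_def)

lemma laplacian_kernel_inv:
  "K \<in> sym_classes G \<Longrightarrow> s \<in> carrier G \<Longrightarrow> laplacian_kernel K (inv s) = laplacian_kernel K s"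
  by (simp add: laplacian_kernel_def sym_class_inv inv_eq_1_iff)

section \<open>Linear independence of the Laplacians\<close>

lemma laplacian_independent:
  assumes 0: "\<And>f. f \<in> L2 G \<Longrightarrow>
      (\<Sum>K\<in>sym_classes G. complex_of_real (c K) *\<^sub>f laplacian G K f) = 0"
    and L: "L \<in> sym_classes G"
  shows "c L = 0"
proof -
  obtain s where s: "s \<in> L"
    using sym_class_nonempty[OF L] by blast
  then have sG: "s \<in> carrier G" "s \<noteq> \<one>"
    using sym_classes_subset[OF L] by auto
  \<comment> \<open>Evaluating at \<open>inv s\<close> makes the averaging over \<open>K\<close> see
    the point mass only when \<open>s\<close> lies in \<open>K\<close>, that is, for
    \<open>K = L\<close>. The identity part of the Laplacian contributes nothing there because
    \<open>s\<close> is not \<open>\<one>\<close>.\<close>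
  define \<delta> :: "'a \<Rightarrow> complex" where "\<delta> x = (if x = \<one> then 1 else 0)" for x
  have \<delta>: "\<delta> \<in> L2 G"
    by (auto simp: \<delta>_def L2_def)
  have lap: "laplacian G K \<delta> (inv s) = (if K = L then - 1 / of_nat (card L) else 0)"
    if K: "K \<in> sym_classes G" for K
  proof -
    have KG: "K \<subseteq> carrier G"
      using sym_classes_subset[OF K] by auto
    have "inv s \<otimes> t = \<one> \<longleftrightarrow> t = s" if "t \<in> carrier G" for t
      using sG that by (metis inv_closed inv_equality inv_inv l_inv)
    then have "laplacian G K \<delta> (inv s) =
        (\<Sum>t\<in>carrier G. complex_of_real (laplacian_kernel K t) * (if t = s then 1 else 0))"
      using laplacian_eq_conv[OF KG \<delta>] sG by (simp add: conv_apply \<delta>_def)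
    also have "\<dots> = complex_of_real (laplacian_kernel K s)"
      using finite_carrier sG by (simp add: if_distrib cong: if_cong)
    also have "s \<in> K \<longleftrightarrow> K = L"
      using sym_classes_disjoint[OF K L _ s] s by auto
    then have "complex_of_real (laplacian_kernel K s) = (if K = L then - 1 / of_nat (card L) else 0)"
      using sG by (simp add: laplacian_kernel_def)
    finally show ?thesis .
  qed
  have "0 = (\<Sum>K\<in>sym_classes G. complex_of_real (c K) * laplacian G K \<delta> (inv s))"
    using arg_cong[OF 0[OF \<delta>], of "\<lambda>f. f (inv s)"] by (simp add: sum_fun_apply fscale_def)
  also have "\<dots> = (\<Sum>K\<in>sym_classes G. if K = L then - complex_of_real (c L) / of_nat (card L) else 0)"
    by (intro sum.cong) (auto simp: lap)
  also have "\<dots> = - complex_of_real (c L) / of_nat (card L)"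
    using finite_sym_classes L by simp
  finally show ?thesis
    using sym_class_finite[OF L] sym_class_nonempty[OF L] by simp
qed

section \<open>The convolution kernel of an admissible operator\<close>

lemma L2_finite_subspace: "finite_subspace (carrier G) (L2 G)"
  by unfold_locales
    (use finite_carrier in \<open>auto simp: L2_def cfun.subspace_def fscale_def\<close>)

text \<open>Equivariance recovers \<open>T\<close> from the values at \<open>\<one>\<close> of its
  images of point masses. Hermitian symmetry gives one relation between
  \<open>\<kappa> (inv s)\<close> and \<open>\<kappa> s\<close>, invariance under conjugation
  another, and together they make \<open>\<kappa>\<close> real.\<close>

lemma admissible_kernel:
  assumes "admissible G T"
  obtains k where "\<And>s. s \<in> carrier G \<Longrightarrow> k (inv s) = k s" "(\<Sum>s\<in>carrier G. k s) = 0"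
    "\<And>f. f \<in> L2 G \<Longrightarrow> T f = conv G k f"
proof -
  note adm = assms[unfolded admissible_def L2_linear_def]
  interpret finite_operator "carrier G" "L2 G" T
    using L2_finite_subspace adm
    by (auto simp: finite_operator_def finite_operator_axioms_def)
  define \<delta> :: "'a \<Rightarrow> 'a \<Rightarrow> complex" where "\<delta> s x = (if x = s then 1 else 0)" for s x
  define \<kappa> where "\<kappa> s = T (\<delta> s) \<one>" for s
  have \<delta>: "\<delta> s \<in> L2 G" if "s \<in> carrier G" for s
    using that by (auto simp: \<delta>_def L2_def)
  \<comment> \<open>Left translation by \<open>inv g\<close> moves the point of evaluation from
    \<open>g\<close> to \<open>\<one>\<close>, where \<open>\<kappa>\<close> records the
    values.\<close>
  have T\<delta>: "T (\<delta> s) g = \<kappa> (inv g \<otimes> s)" if g: "g \<in> carrier G" and s: "s \<in> carrier G" for g s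
  proof -
    have "g \<otimes> x = s \<longleftrightarrow> x = inv g \<otimes> s" if "x \<in> carrier G" for x
      using g s that by (metis inv_closed inv_solve_left)
    then have "left_translation G (inv g) (\<delta> s) = \<delta> (inv g \<otimes> s)"
      using g s by (auto simp: left_translation_def restr_def \<delta>_def fun_eq_iff)
    then have "\<kappa> (inv g \<otimes> s) = left_translation G (inv g) (T (\<delta> s)) \<one>"
      unfolding \<kappa>_def using adm g \<delta>[OF s] by (metis inv_closed)
    then show ?thesis
      using g by (simp add: left_translation_def restr_def)
  qed
  have conv: "T f g = (\<Sum>s\<in>carrier G. \<kappa> s * f (g \<otimes> s))"
    if f: "f \<in> L2 G" and g: "g \<in> carrier G" for f g
  proof -
    have "f = (\<Sum>s\<in>carrier G. f s *\<^sub>f \<delta> s)"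
      using f finite_carrier
      by (auto simp: fun_eq_iff sum_fun_apply fscale_def \<delta>_def L2_def if_distrib cong: if_cong)
    then have "T f = (\<Sum>s\<in>carrier G. f s *\<^sub>f T (\<delta> s))"
      using T_sum[OF finite_carrier, of \<delta> f] \<delta> by simp
    then have "T f g = (\<Sum>s\<in>carrier G. f s * \<kappa> (inv g \<otimes> s))"
      using g by (simp add: sum_fun_apply fscale_def T\<delta>)
    also have "\<dots> = (\<Sum>s\<in>carrier G. f (g \<otimes> s) * \<kappa> (inv g \<otimes> (g \<otimes> s)))"
      by (rule sum.reindex_bij_betw[OF bij_left_mult[OF g], symmetric])
    also have "\<dots> = (\<Sum>s\<in>carrier G. \<kappa> s * f (g \<otimes> s))"
      using g by (intro sum.cong) (auto simp: m_assoc[symmetric])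
    finally show ?thesis .
  qed
  have L2_inner: "L2_inner G f h = 1 / of_nat (card (carrier G)) * finner (carrier G) f h" for f h
    by (simp add: L2_inner_def finner_def)
  have card: "card (carrier G) \<noteq> 0"
    using finite_carrier one_closed by auto
  have herm: "finner (carrier G) (T f) h = finner (carrier G) f (T h)"
    if "f \<in> L2 G" "h \<in> L2 G" for f h
    using adm that card by (auto simp: L2_inner)
  have conj: "finner (carrier G) (cnj \<circ> f) (T (cnj \<circ> f)) = finner (carrier G) f (T f)"
    if "f \<in> L2 G" for f
    using adm that card by (auto simp: L2_inner)
  have finner_\<delta>: "finner (carrier G) (\<delta> s) h = h s" "finner (carrier G) h (\<delta> s) = cnj (h s)"
    if "s \<in> carrier G" for s h
    using that finite_carrier by (auto simp: finner_def \<delta>_def if_distrib if_distribR cong: if_cong)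
  \<comment> \<open>The Hermitian condition is tested on the point masses at \<open>\<one>\<close>
    and \<open>s\<close>.\<close>
  have \<kappa>_cnj: "cnj (\<kappa> (inv s)) = \<kappa> s" if s: "s \<in> carrier G" for s
    using herm[OF \<delta>[OF one_closed] \<delta>[OF s]] s by (simp add: finner_\<delta> T\<delta>)
  \<comment> \<open>Polarization: testing the conjugation invariance on \<open>\<delta>\<^sub>1 + \<i> \<delta>\<^sub>s\<close> isolates \<open>\<kappa> s\<close> and \<open>\<kappa> (s\<^sup>-\<^sup>1)\<close>.\<close>
  have \<kappa>_inv: "\<kappa> (inv s) = \<kappa> s" if s: "s \<in> carrier G" for s
  proof -
    define f where "f c = \<delta> \<one> + c *\<^sub>f \<delta> s" for c
    have fL2: "f c \<in> L2 G" for c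
      unfolding f_def using \<delta> s by (intro cfun.subspace_add cfun.subspace_scale subsp) auto
    have cnj_f: "cnj \<circ> f \<i> = f (- \<i>)"
      by (auto simp: f_def fun_eq_iff \<delta>_def fscale_def)
    have "T (f c) = T (\<delta> \<one>) + c *\<^sub>f T (\<delta> s)" for c
      unfolding f_def using \<delta> s cfun.subspace_scale[OF subsp \<delta>[OF s]]
      by (simp add: T_add T_scale del: plus_fun_apply)
    then have Tf: "T (f c) g = T (\<delta> \<one>) g + c * T (\<delta> s) g" for c g
      by (simp add: fscale_def)
    have "finner (carrier G) (f c) h = h \<one> + cnj c * h s" for c h
    proof -
      have "finner (carrier G) (f c) h = cnj (finner (carrier G) h (f c))"
        by (simp add: cnj_finner)
      also have "\<dots> = h \<one> + cnj c * h s"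
        unfolding f_def finner_add_right finner_scale_right using s by (simp add: finner_\<delta>)
      finally show ?thesis .
    qed
    then have "finner (carrier G) (f c) (T (f c)) =
        \<kappa> \<one> + c * \<kappa> s + cnj c * (\<kappa> (inv s) + c * \<kappa> \<one>)" for c
      using s by (simp add: Tf T\<delta>)
    with conj[OF fL2[of \<i>]] show ?thesis
      unfolding cnj_f by (simp add: algebra_simps)
  qed
  define k where "k s = Re (\<kappa> s)" for s
  \<comment> \<open>By \<open>\<kappa>_cnj\<close> and \<open>\<kappa>_inv\<close>,
    \<open>\<kappa> s\<close> is its own conjugate, so passing to the real part loses
    nothing.\<close>
  have k: "complex_of_real (k s) = \<kappa> s" if "s \<in> carrier G" for s
    using \<kappa>_cnj[OF that] \<kappa>_inv[OF that] by (simp add: k_def complex_eq_iff)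
  show ?thesis
  proof (rule that[of k])
    show "k (inv s) = k s" if "s \<in> carrier G" for s
      using \<kappa>_inv[OF that] by (simp add: k_def)
    show "T f = conv G k f" if f: "f \<in> L2 G" for f
    proof
      fix g
      show "T f g = conv G k f g"
        using conv[OF f, of g] T_closed[OF f] by (auto simp: conv_apply k L2_def)
    qed
    \<comment> \<open>\<open>T\<close> annihilates the constant 1, and the convolution formula at
      \<open>\<one>\<close> turns this into the total mass of the kernel.\<close>
    have "restr G (\<lambda>_. 1) \<in> L2 G"
      by (auto simp: restr_def L2_def)
    from conv[OF this one_closed] have "0 = (\<Sum>s\<in>carrier G. \<kappa> s)"
      using adm by (simp add: restr_def)
    then have "complex_of_real (\<Sum>s\<in>carrier G. k s) = 0"
      by (simp add: k)
    then show "(\<Sum>s\<in>carrier G. k s) = 0"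
      using of_real_eq_0_iff by blast
  qed
qed

text \<open>Both sides are linear in a class function \<open>\<psi>\<close>. The zero total of
  \<open>k\<close> removes the weight at \<open>\<one>\<close>, leaving multiples of
  \<open>\<psi> \<one> - p K\<close>, which is \<open>D\<close> times the mean of the Laplacian of
  \<open>K\<close> when \<open>D\<close> is nonzero. The weights do not involve
  \<open>\<sigma>\<close>.\<close>

lemma omega_decomposition:
  assumes "matrix_rep G \<sigma>"
    and k: "\<And>s. s \<in> carrier G \<Longrightarrow> k (inv s) = k s" "(\<Sum>s\<in>carrier G. k s) = 0"
    and T: "\<And>f. f \<in> L2 G \<Longrightarrow> T f = conv G k f"
  shows "omega G T \<sigma> =
    (\<Sum>K\<in>sym_classes G. complex_of_real (- (\<Sum>s\<in>K. k s)) * omega G (laplacian G K) \<sigma>)"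
proof -
  interpret right_invariant_space G "coeff_space G \<sigma>"
    by (rule right_invariant_coeff_space[OF assms(1)])
  have L2: "f \<in> L2 G" if "f \<in> coeff_space G \<sigma>" for f
    using supp[OF that] by (auto simp: L2_def)
  \<comment> \<open>One \<open>\<psi>\<close> and one \<open>D\<close> serve \<open>T\<close> and
    all Laplacians, since they come from the coefficient space alone. Only division by
    \<open>D\<close> occurs, never cancellation, so \<open>D = 0\<close> does no harm.\<close>
  obtain \<psi> D where \<psi>:
      "\<And>s t. s \<in> carrier G \<Longrightarrow> t \<in> carrier G \<Longrightarrow> \<psi> (t \<otimes> s \<otimes> inv t) = \<psi> s"
      "\<And>s. s \<in> carrier G \<Longrightarrow> \<psi> (inv s) = \<psi> s"
    and mean: "\<And>k T. (\<And>s. s \<in> carrier G \<Longrightarrow> k (inv s) = k s) \<Longrightarrow>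
       (\<And>f. f \<in> coeff_space G \<sigma> \<Longrightarrow> T f = conv G k f) \<Longrightarrow>
       mean_eigenvalue T (coeff_space G \<sigma>) = (\<Sum>s\<in>carrier G. complex_of_real (k s) * \<psi> s) / D"
    by (rule mean_eigenvalue_class_function) blast
  \<comment> \<open>The common value of \<open>\<psi>\<close> on \<open>K\<close>, read off at an
    arbitrary element.\<close>
  define p where "p K = \<psi> (SOME s. s \<in> K)" for K
  have p: "\<psi> s = p K" if "K \<in> sym_classes G" "s \<in> K" for K s
    unfolding p_def
    by (rule class_function_const[of \<psi>]) (use \<psi> that in \<open>auto intro: someI[of "\<lambda>s. s \<in> K"]\<close>)
  have lap: "omega G (laplacian G K) \<sigma> = (\<psi> \<one> - p K) / D" if K: "K \<in> sym_classes G" for K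
  proof -
    have KG: "K \<subseteq> carrier G"
      using sym_classes_subset[OF K] by auto
    have "(\<Sum>s\<in>K. \<psi> s) = of_nat (card K) * p K"
      using p[OF K] by simp
    then have "(\<Sum>s\<in>carrier G. complex_of_real (laplacian_kernel K s) * \<psi> s) = \<psi> \<one> - p K"
      unfolding sum_laplacian_kernel[OF KG]
      using sym_class_finite[OF K] sym_class_nonempty[OF K] by simp
    then show ?thesis
      unfolding omega_def using mean[OF laplacian_kernel_inv[OF K] laplacian_eq_conv[OF KG L2]]
      by simp
  qed
  have "(\<Sum>s\<in>carrier G. complex_of_real (k s) * \<psi> s) =
      complex_of_real (k \<one>) * \<psi> \<one> + (\<Sum>K\<in>sym_classes G. complex_of_real (\<Sum>s\<in>K. k s) * p K)"
    unfolding sum_sym_classes of_real_sum sum_distrib_right by (simp add: p)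
  \<comment> \<open>Substituting this pairs every \<open>p K\<close> with a
    \<open>\<psi> \<one>\<close> of the same weight, which is the shape found in
    \<open>lap\<close>.\<close>
  also have "k \<one> = - (\<Sum>K\<in>sym_classes G. \<Sum>s\<in>K. k s)"
    using k(2) unfolding sum_sym_classes by simp
  also have "complex_of_real (- (\<Sum>K\<in>sym_classes G. \<Sum>s\<in>K. k s)) * \<psi> \<one> +
      (\<Sum>K\<in>sym_classes G. complex_of_real (\<Sum>s\<in>K. k s) * p K) =
      (\<Sum>K\<in>sym_classes G. complex_of_real (- (\<Sum>s\<in>K. k s)) * (\<psi> \<one> - p K))"
    by (simp add: right_diff_distrib sum_subtractf sum_negf sum_distrib_right)
  finally have total: "(\<Sum>s\<in>carrier G. complex_of_real (k s) * \<psi> s) =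
      (\<Sum>K\<in>sym_classes G. complex_of_real (- (\<Sum>s\<in>K. k s)) * (\<psi> \<one> - p K))" .
  have "omega G T \<sigma> = (\<Sum>s\<in>carrier G. complex_of_real (k s) * \<psi> s) / D"
    unfolding omega_def using k(1) T[OF L2] by (rule mean)
  then show ?thesis
    unfolding total sum_divide_distrib by (simp add: lap)
qed

end

theorem theorem1:
  fixes G :: "('a, 'b) monoid_scheme"
  assumes "group G" and "finite (carrier G)"
  shows "(\<forall>c :: 'a set \<Rightarrow> real.
            (\<forall>f\<in>L2 G. (\<Sum>K\<in>sym_classes G. complex_of_real (c K) *\<^sub>f laplacian G K f) = 0) \<longrightarrow>
            (\<forall>K\<in>sym_classes G. c K = 0)) \<and>
         (\<forall>T. admissible G T \<longrightarrow>
            (\<exists>\<alpha> :: 'a set \<Rightarrow> real. \<forall>\<rho>\<in>dual G. \<forall>\<sigma>\<in>\<rho>. unitary_rep G \<sigma> \<longrightarrow>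
               omega G T \<sigma> =
                 (\<Sum>K\<in>sym_classes G. complex_of_real (\<alpha> K) * omega G (laplacian G K) \<sigma>)))"
proof -
  interpret finite_grp G
    using assms by (simp add: finite_grp_def finite_grp_axioms_def)
  show ?thesis
  proof (intro conjI allI impI)
    fix c :: "'a set \<Rightarrow> real"
    assume "\<forall>f\<in>L2 G. (\<Sum>K\<in>sym_classes G. complex_of_real (c K) *\<^sub>f laplacian G K f) = 0"
    then show "\<forall>K\<in>sym_classes G. c K = 0"
      using laplacian_independent by blast
  next
    fix T
    assume "admissible G T"
    then obtain k where k: "\<And>s. s \<in> carrier G \<Longrightarrow> k (inv\<^bsub>G\<^esub> s) = k s"
      "(\<Sum>s\<in>carrier G. k s) = 0" "\<And>f. f \<in> L2 G \<Longrightarrow> T f = conv G k f"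
      by (rule admissible_kernel) blast
    \<comment> \<open>The coefficients are computed from \<open>k\<close> alone, so a single
      \<alpha> is valid on the whole dual.\<close>
    have "omega G T \<sigma> = (\<Sum>K\<in>sym_classes G.
        complex_of_real (- (\<Sum>s\<in>K. k s)) * omega G (laplacian G K) \<sigma>)" if "unitary_rep G \<sigma>" for \<sigma>
      using that k by (intro omega_decomposition) (auto simp: unitary_rep_def)
    then show "\<exists>\<alpha> :: 'a set \<Rightarrow> real. \<forall>\<rho>\<in>dual G. \<forall>\<sigma>\<in>\<rho>. unitary_rep G \<sigma> \<longrightarrow>
        omega G T \<sigma> =
          (\<Sum>K\<in>sym_classes G. complex_of_real (\<alpha> K) * omega G (laplacian G K) \<sigma>)"
      by (intro exI[of _ "\<lambda>K. - (\<Sum>s\<in>K. k s)"]) blast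
  qed
qed

end
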